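(* Let $\mathcal T$ and $\mathcal S$ be local approximation classes in $\mathbb{R}^n$ such that $\mathcal T$ is separated at infinity in $\mathcal S$. Let $x\in\mathbb{R}^n$ and let $A\subseteq\mathbb{R}^n$ be a closed set containing $x$. If $\mathrm{Tan}(A,x)\subseteq\mathcal S$, then either $\mathrm{Tan}(A,x)\subseteq\overline{\mathcal T}$ or $\mathrm{Tan}(A,x)\subseteq\mathcal T^\perp$.
   Context: $B(x,r)$ denotes the closed ball in $\mathbb{R}^n$. $\mathfrak C(0)$ is the collection of closed subsets of $\mathbb{R}^n$ containing $0$. For $A,B\subseteq\mathbb{R}^n$ with $B\neq\emptyset$, $\mathrm{ex}(A,B)=\sup_{a\in A}\inf_{b\in B}|a-b|$, with $\mathrm{ex}(\emptyset,B)=0$. Nonempty closed sets $A_i$ converge to a nonempty closed set $A$ (Attouch--Wets topology, which is metrizable), $A_i\to A$, if $\mathrm{ex}(A_i\cap B(0,r),A)\to0$ and $\mathrm{ex}(A\cap B(0,r),A_i)\to 0$ for all $r>0$. For $\mathcal S\subseteq\mathfrak C(0)$, $\overline{\mathcal S}$ is the closure of $\mathcal S$ in $\mathfrak C(0)$ in this topology. A local approximation class is a nonempty collection $\mathcal S\subseteq\mathfrak C(0)$ such that $\lambda S\in\mathcal S$ for all $S\in\mathcal S$, $\lambda>0$. For nonempty $A,B$ put $\widetilde{\mathrm D}^{x,r}[A,B]=\frac1r\max\{\mathrm{ex}(A\cap B(x,r),B),\mathrm{ex}(B\cap B(x,r),A)\}$, and $\Theta^{\mathcal S}_A(x,r)=\inf_{S\in\mathcal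 S}\widetilde{\mathrm D}^{x,r}[A,x+S]$. For closed $A$ and $x\in A$, $\mathrm{Tan}(A,x)$ is the collection of $T\in\mathfrak C(0)$ such that $(A-x)/r_i\to T$ for some sequence $r_i>0$ with $r_i\to0$. Singular class: $\mathcal T^\perp=\{D\in\mathfrak C(0):\liminf_{r\downarrow0}\Theta^{\mathcal T}_D(0,r)>0\}$ (equivalently, $\{D\in\mathfrak C(0):\mathrm{Tan}(D,0)\cap\overline{\mathcal T}=\emptyset\}$). $\mathcal T$ is separated at infinity in $\mathcal S$ if there exists $\phi>0$ such that $\limsup_{r\uparrow\infty}\Theta^{\mathcal T}_S(0,r)\geq\phi$ for all $S\in\mathcal S\setminus\overline{\mathcal T}$. *)

theory Defs
  imports "HOL-Analysis.Analysis"
begin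

text \<open>Suprema and infima are taken in \<open>ennreal\<close>, so that the supremum over the empty set is
  \<open>0\<close> and unbounded sets need no convention.\<close>

definition excess :: "'a::euclidean_space set \<Rightarrow> 'a set \<Rightarrow> ennreal" where
  "excess A B = (SUP a\<in>A. INF b\<in>B. ennreal (dist a b))"

definition closed_through_0 :: "'a::euclidean_space set set" where
  "closed_through_0 = {A. closed A \<and> 0 \<in> A}"

definition aw_tendsto :: "(nat \<Rightarrow> 'a::euclidean_space set) \<Rightarrow> 'a set \<Rightarrow> bool" where
  "aw_tendsto X A \<longleftrightarrow>
     (\<forall>r>0. (\<lambda>i. excess (X i \<inter> cball 0 r) A) \<longlonglongrightarrow> 0 \<and>
            (\<lambda>i. excess (A \<inter> cball 0 r) (X i)) \<longlonglongrightarrow> 0)"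

text \<open>A metrizable topology is determined by its convergent sequences: its open sets are the
  sequentially open ones. This is how the Attouch--Wets topology on the closed sets through the
  origin is obtained from \<open>aw_tendsto\<close>. The lemmas \<open>limitin_attouch_wets\<close> and
  \<open>closure_of_attouch_wets\<close> below confirm that the convergent sequences of the resulting topology
  are the intended ones, and that closures are computed by sequences.\<close>

definition attouch_wets :: "'a::euclidean_space set topology" where
  "attouch_wets = topology (\<lambda>U. U \<subseteq> closed_through_0 \<and>
     (\<forall>A\<in>U. \<forall>X. range X \<subseteq> closed_through_0 \<longrightarrow> aw_tendsto X A \<longrightarrow>
        (\<forall>\<^sub>F i in sequentially. X i \<in> U)))"

abbreviation aw_closure :: "'a::euclidean_space set set \<Rightarrow> 'a set set" where
  "aw_closure \<S> \<equiv> attouch_wets closure_of \<S>"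

definition local_approximation_class :: "'a::euclidean_space set set \<Rightarrow> bool" where
  "local_approximation_class \<S> \<longleftrightarrow> \<S> \<noteq> {} \<and> \<S> \<subseteq> closed_through_0 \<and>
     (\<forall>S\<in>\<S>. \<forall>c>0. (*\<^sub>R) c ` S \<in> \<S>)"

definition rel_excess :: "'a::euclidean_space \<Rightarrow> real \<Rightarrow> 'a set \<Rightarrow> 'a set \<Rightarrow> ennreal" where
  "rel_excess x r A B =
     max (excess (A \<inter> cball x r) B) (excess (B \<inter> cball x r) A) / ennreal r"

definition \<Theta> :: "'a::euclidean_space set set \<Rightarrow> 'a set \<Rightarrow> 'a \<Rightarrow> real \<Rightarrow> ennreal" where
  "\<Theta> \<S> A x r = (INF S\<in>\<S>. rel_excess x r A ((+) x ` S))"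

definition Tan :: "'a::euclidean_space set \<Rightarrow> 'a \<Rightarrow> 'a set set" where
  "Tan A x = {T \<in> closed_through_0.
     \<exists>r. (\<forall>i. r i > 0) \<and> r \<longlonglongrightarrow> 0 \<and> aw_tendsto (\<lambda>i. (\<lambda>a. (a - x) /\<^sub>R r i) ` A) T}"

definition singular_class :: "'a::euclidean_space set set \<Rightarrow> 'a set set" where
  "singular_class \<T> = {D \<in> closed_through_0. Liminf (at_right 0) (\<lambda>r. \<Theta> \<T> D 0 r) > 0}"

definition separated_at_infinity ::
    "'a::euclidean_space set set \<Rightarrow> 'a set set \<Rightarrow> bool" where
  "separated_at_infinity \<T> \<S> \<longleftrightarrow>
     (\<exists>\<phi>::real. \<phi> > 0 \<and>
        (\<forall>S\<in>\<S> - aw_closure \<T>. Limsup at_top (\<lambda>r. \<Theta> \<T> S 0 r) \<ge> ennreal \<phi>))"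

lemma openin_attouch_wets:
  "openin attouch_wets U \<longleftrightarrow> U \<subseteq> closed_through_0 \<and>
     (\<forall>A\<in>U. \<forall>X. range X \<subseteq> closed_through_0 \<longrightarrow> aw_tendsto X A \<longrightarrow>
        (\<forall>\<^sub>F i in sequentially. X i \<in> U))"
proof -
  let ?P = "\<lambda>U :: 'a set set. U \<subseteq> closed_through_0 \<and>
     (\<forall>A\<in>U. \<forall>X. range X \<subseteq> closed_through_0 \<longrightarrow> aw_tendsto X A \<longrightarrow>
        (\<forall>\<^sub>F i in sequentially. X i \<in> U))"
  have "?P (S \<inter> T)" if "?P S" "?P T" for S T
    using that by (auto simp: eventually_conj_iff)
  moreover have "?P (\<Union>\<K>)" if "\<forall>K\<in>\<K>. ?P K" for \<K>
    using that by (smt (verit) Sup_le_iff UnionE UnionI eventually_mono)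
  ultimately have "istopology ?P" unfolding istopology_def by blast
  then show ?thesis unfolding attouch_wets_def by (subst topology_inverse') auto
qed

lemma topspace_attouch_wets: "topspace attouch_wets = closed_through_0"
proof (rule antisym)
  show "topspace attouch_wets \<subseteq> closed_through_0"
    using openin_topspace openin_attouch_wets by blast
  have "openin attouch_wets closed_through_0"
    unfolding openin_attouch_wets by (auto intro!: always_eventually)
  then show "closed_through_0 \<subseteq> topspace attouch_wets" by (rule openin_subset)
qed

lemma excess_less_imp_near:
  assumes "excess A B < ennreal e" "a \<in> A"
  shows "\<exists>b\<in>B. dist a b < e"
proof -
  have "(INF b\<in>B. ennreal (dist a b)) < ennreal e"
    using assms unfolding excess_def by (meson SUP_upper order_le_less_trans)
  then show ?thesis by (auto simp: INF_less_iff ennreal_less_iff)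
qed

lemma near_imp_excess_le:
  assumes "\<And>a. a \<in> A \<Longrightarrow> \<exists>b\<in>B. dist a b \<le> e"
  shows "excess A B \<le> ennreal e"
  unfolding excess_def
  by (rule SUP_least) (meson INF_lower2 assms ennreal_leI)

lemma excess_mono: "A \<subseteq> A' \<Longrightarrow> excess A B \<le> excess A' B"
  unfolding excess_def by (rule SUP_subset_mono) auto

lemma excess_triangle:
  assumes "excess (A \<inter> cball 0 r) B < ennreal d" "excess (B \<inter> cball 0 (r + 1)) C < ennreal e" "d \<le> 1"
  shows "excess (A \<inter> cball 0 r) C \<le> ennreal (d + e)"
proof (rule near_imp_excess_le)
  fix a assume a: "a \<in> A \<inter> cball 0 r"
  obtain b where b: "b \<in> B" "dist a b < d" using excess_less_imp_near[OF assms(1) a] by auto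
  have "dist 0 b \<le> dist 0 a + dist a b" by (rule dist_triangle)
  then have "b \<in> B \<inter> cball 0 (r + 1)" using a b assms(3) by simp
  from excess_less_imp_near[OF assms(2) this] obtain c where c: "c \<in> C" "dist b c < e" by auto
  have "dist a c \<le> dist a b + dist b c" by (rule dist_triangle)
  then show "\<exists>c\<in>C. dist a c \<le> d + e" using b c by (intro bexI[of _ c]) auto
qed

definition aw_nbhd :: "'a::euclidean_space set \<Rightarrow> real \<Rightarrow> real \<Rightarrow> 'a set set" where
  "aw_nbhd A r e = {B \<in> closed_through_0.
     excess (A \<inter> cball 0 r) B < ennreal e \<and> excess (B \<inter> cball 0 r) A < ennreal e}"

lemma aw_nbhd_refl:
  assumes "A \<in> closed_through_0" "e > 0" shows "A \<in> aw_nbhd A r e"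
proof -
  have "excess (A \<inter> cball 0 r) A \<le> ennreal 0" by (rule near_imp_excess_le) force
  then show ?thesis using assms by (auto simp: aw_nbhd_def ennreal_less_iff)
qed

lemma aw_nbhd_mono:
  assumes "r \<le> r'" "e' \<le> e" shows "aw_nbhd A r' e' \<subseteq> aw_nbhd A r e"
proof
  fix B assume B: "B \<in> aw_nbhd A r' e'"
  have "excess (A \<inter> cball 0 r) B \<le> excess (A \<inter> cball 0 r') B"
    and "excess (B \<inter> cball 0 r) A \<le> excess (B \<inter> cball 0 r') A"
    using assms by (auto intro!: excess_mono)
  moreover have "ennreal e' \<le> ennreal e" using assms by (simp add: ennreal_leI)
  ultimately show "B \<in> aw_nbhd A r e"
    using B unfolding aw_nbhd_def by (auto intro: order.strict_trans2 order.strict_trans1)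
qed

lemma aw_nbhd_nested:
  assumes "e > 0" "B \<in> aw_nbhd A (r + 1) (min 1 (e / 4))"
  shows "aw_nbhd B (r + 1) (min 1 (e / 4)) \<subseteq> aw_nbhd A r e"
proof
  let ?d = "min 1 (e / 4)"
  fix C assume C: "C \<in> aw_nbhd B (r + 1) ?d"
  have B': "B \<in> aw_nbhd A r ?d" and C': "C \<in> aw_nbhd B r ?d"
    using assms(2) C aw_nbhd_mono[of r "r+1" ?d ?d] by auto
  have "excess (A \<inter> cball 0 r) C \<le> ennreal (?d + ?d)"
    using B' C by (intro excess_triangle) (auto simp: aw_nbhd_def)
  moreover have "excess (C \<inter> cball 0 r) A \<le> ennreal (?d + ?d)"
    using C' assms(2) by (intro excess_triangle) (auto simp: aw_nbhd_def)
  moreover have "ennreal (?d + ?d) < ennreal e" using assms(1) by (simp add: ennreal_less_iff)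
  ultimately show "C \<in> aw_nbhd A r e" using C by (auto simp: aw_nbhd_def)
qed

lemma aw_tendsto_iff_nbhd:
  assumes "range X \<subseteq> closed_through_0"
  shows "aw_tendsto X A \<longleftrightarrow> (\<forall>r>0. \<forall>e>0. \<forall>\<^sub>F i in sequentially. X i \<in> aw_nbhd A r e)"
proof
  assume *: "aw_tendsto X A"
  show "\<forall>r>0. \<forall>e>0. \<forall>\<^sub>F i in sequentially. X i \<in> aw_nbhd A r e"
  proof (intro allI impI)
    fix r e :: real assume "r > 0" "e > 0"
    then have "\<forall>\<^sub>F i in sequentially. excess (X i \<inter> cball 0 r) A < ennreal e"
        "\<forall>\<^sub>F i in sequentially. excess (A \<inter> cball 0 r) (X i) < ennreal e"
      using * by (auto simp: aw_tendsto_def intro!: order_tendstoD(2)[where y = 0])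
    then show "\<forall>\<^sub>F i in sequentially. X i \<in> aw_nbhd A r e"
      by eventually_elim (use assms in \<open>auto simp: aw_nbhd_def\<close>)
  qed
next
  assume *: "\<forall>r>0. \<forall>e>0. \<forall>\<^sub>F i in sequentially. X i \<in> aw_nbhd A r e"
  have "(\<lambda>i. f i) \<longlonglongrightarrow> 0" if "\<And>e. e > 0 \<Longrightarrow> \<forall>\<^sub>F i in sequentially. f i < ennreal e"
    for f :: "nat \<Rightarrow> ennreal"
  proof (rule order_tendstoI)
    fix a :: ennreal assume "0 < a"
    then obtain b where "0 < b" "b < a" using dense by blast
    then obtain e where "b = ennreal e" "e > 0" by (cases b) auto
    then show "\<forall>\<^sub>F i in sequentially. f i < a"
      using that[of e] \<open>b < a\<close> by (auto elim: eventually_mono)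
  qed simp
  then show "aw_tendsto X A"
    unfolding aw_tendsto_def using *
    by (auto simp: aw_nbhd_def eventually_conj_iff)
qed

lemma aw_nbhd_open:
  assumes "A \<in> closed_through_0" "e > 0"
  shows "\<exists>U. openin attouch_wets U \<and> A \<in> U \<and> U \<subseteq> aw_nbhd A r e"
proof -
  define U where "U = {B \<in> closed_through_0. \<exists>r'>0. \<exists>e'>0. aw_nbhd B r' e' \<subseteq> aw_nbhd A r e}"
  have "openin attouch_wets U"
    unfolding openin_attouch_wets
  proof (intro conjI ballI allI impI)
    fix B X assume B: "B \<in> U" and X: "range X \<subseteq> closed_through_0" "aw_tendsto X B"
    obtain r' e' where re: "r' > 0" "e' > 0" "aw_nbhd B r' e' \<subseteq> aw_nbhd A r e"
      using B by (auto simp: U_def)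
    have "\<forall>\<^sub>F i in sequentially. X i \<in> aw_nbhd B (r' + 1) (min 1 (e' / 4))"
      using X re by (simp add: aw_tendsto_iff_nbhd)
    then show "\<forall>\<^sub>F i in sequentially. X i \<in> U"
    proof eventually_elim
      case (elim i)
      have "r' + 1 > 0" "min 1 (e' / 4) > 0" using re by auto
      then show ?case
        using aw_nbhd_nested[OF re(2) elim] re(3) X(1) unfolding U_def by blast
    qed
  qed (auto simp: U_def)
  moreover have "A \<in> U"
    using assms aw_nbhd_mono[of r "max r 1" e e A] unfolding U_def
    by (intro CollectI conjI exI[of _ "max r 1"] exI[of _ e]) auto
  moreover have "U \<subseteq> aw_nbhd A r e" using aw_nbhd_refl by (fastforce simp: U_def)
  ultimately show ?thesis by blast
qed

lemma limitin_attouch_wets: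
  assumes "range X \<subseteq> closed_through_0" "A \<in> closed_through_0"
  shows "limitin attouch_wets X A sequentially \<longleftrightarrow> aw_tendsto X A"
proof
  assume L: "limitin attouch_wets X A sequentially"
  show "aw_tendsto X A"
    unfolding aw_tendsto_iff_nbhd[OF assms(1)]
  proof (intro allI impI)
    fix r e :: real assume "r > 0" "e > 0"
    then obtain U where "openin attouch_wets U" "A \<in> U" "U \<subseteq> aw_nbhd A r e"
      using aw_nbhd_open assms(2) by blast
    then show "\<forall>\<^sub>F i in sequentially. X i \<in> aw_nbhd A r e"
      using L unfolding limitin_def by (metis (mono_tags, lifting) eventually_mono subsetD)
  qed
qed (use assms in \<open>auto simp: limitin_def topspace_attouch_wets openin_attouch_wets\<close>)

lemma closure_of_attouch_wets:
  assumes "\<S> \<subseteq> closed_through_0"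
  shows "aw_closure \<S> = {A \<in> closed_through_0. \<exists>X. range X \<subseteq> \<S> \<and> aw_tendsto X A}"
proof (intro set_eqI iffI)
  fix A assume A: "A \<in> aw_closure \<S>"
  then have A0: "A \<in> closed_through_0" by (simp add: in_closure_of topspace_attouch_wets)
  have "\<exists>B. B \<in> \<S> \<and> B \<in> aw_nbhd A (real (Suc n)) (1 / real (Suc n))" for n
    using aw_nbhd_open[OF A0, of "1 / real (Suc n)" "real (Suc n)"] A
    by (auto simp: in_closure_of)
  then obtain X where X: "\<And>n. X n \<in> \<S>"
      "\<And>n. X n \<in> aw_nbhd A (real (Suc n)) (1 / real (Suc n))" by metis
  have rX: "range X \<subseteq> closed_through_0" using X(1) assms by auto
  have "aw_tendsto X A"
    unfolding aw_tendsto_iff_nbhd[OF rX]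
  proof (intro allI impI)
    fix r e :: real assume "r > 0" "e > 0"
    have "\<forall>\<^sub>F n in sequentially. 1 / real (Suc n) < e"
      using \<open>e > 0\<close> LIMSEQ_inverse_real_of_nat
      by (auto simp: inverse_eq_divide dest: order_tendstoD(2))
    moreover have "\<forall>\<^sub>F n in sequentially. r \<le> real n"
      using filterlim_real_sequentially by (simp add: filterlim_at_top)
    ultimately show "\<forall>\<^sub>F n in sequentially. X n \<in> aw_nbhd A r e"
    proof eventually_elim
      case (elim n)
      then show ?case using X(2)[of n] aw_nbhd_mono[of r "real (Suc n)" "1 / real (Suc n)" e A] by auto
    qed
  qed
  then show "A \<in> {A \<in> closed_through_0. \<exists>X. range X \<subseteq> \<S> \<and> aw_tendsto X A}" using A0 X(1) by auto
next
  fix A assume "A \<in> {A \<in> closed_through_0. \<exists>X. range X \<subseteq> \<S> \<and> aw_tendsto X A}"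
  then obtain X where A0: "A \<in> closed_through_0" and X: "range X \<subseteq> \<S>" "aw_tendsto X A" by auto
  have "\<exists>B\<in>\<S>. B \<in> U" if U: "openin attouch_wets U" "A \<in> U" for U
  proof -
    have "\<forall>\<^sub>F i in sequentially. X i \<in> U" using U X assms unfolding openin_attouch_wets by blast
    then show ?thesis using X(1) by (auto simp: eventually_sequentially)
  qed
  then show "A \<in> aw_closure \<S>" using A0 by (auto simp: in_closure_of topspace_attouch_wets)
qed

end

theory Submission
  imports Defs "HOL-Complex_Analysis.Great_Picard"
begin

text \<open>
  Translate \<open>x\<close> to the origin and let \<open>\<theta> r\<close> be the relative distance at scale \<open>r\<close> between \<open>A\<close> and the
  nearest member of \<open>\<T>\<close>. Since \<open>\<T>\<close> is closed under dilation, \<open>\<theta>\<close> of a blow-up \<open>A / b\<close> is \<open>\<theta>\<close> of \<open>A\<close>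
  with the scale multiplied by \<open>b\<close> (\<open>approximable_scale\<close>). Moreover \<open>\<theta>\<close> passes to limits of blow-ups and
  back at the price of halving the scale and of a constant factor (\<open>approximable_transfer\<close>), and
  \<open>\<theta> r' \<le> (r / r') \<theta> r\<close> for \<open>r' \<le> r\<close> (\<open>approximable_smaller_scale\<close>).

  Suppose that one tangent \<open>D\<close> is not singular and another tangent \<open>B\<close> is outside the closure of
  \<open>\<T>\<close>. Then \<open>D\<close> provides arbitrarily small scales at which \<open>\<theta>\<close> is as small as one likes, and,
  because \<open>\<T>\<close> is separated at infinity, \<open>B\<close> provides arbitrarily small scales at which \<open>\<theta>\<close> is at
  least some \<open>c\<close>, where \<open>c\<close> may be chosen small compared with the gap \<open>\<phi>\<close> at infinity. Take scales
  \<open>a \<rightarrow> 0\<close> with \<open>\<theta> a \<rightarrow> 0\<close>, and below each \<open>a\<close> the (almost) largest scale \<open>b\<close> with \<open>\<theta> b \<ge> c\<close>. The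
  bound for smaller scales forces \<open>a / b \<rightarrow> \<infinity>\<close>, so that \<open>\<theta> < c\<close> on longer and longer ranges of
  scales above \<open>b\<close>. By compactness (\<open>aw_sequentially_compact\<close>) the sets \<open>A / b\<close> subconverge to a
  tangent \<open>S\<close>. At all scales from \<open>1\<close> on, \<open>S\<close> is within \<open>3 c < \<phi>\<close> of \<open>\<T>\<close>, so it lies in the closure
  of \<open>\<T>\<close> by separation; but then \<open>\<theta> b < c\<close> for late \<open>b\<close>, a contradiction.
\<close>

section \<open>Relative closeness at a scale\<close>

definition close_on :: "real \<Rightarrow> real \<Rightarrow> 'a::euclidean_space set \<Rightarrow> 'a set \<Rightarrow> bool" where
  "close_on r d A B \<longleftrightarrow>
     (\<forall>a\<in>A \<inter> cball 0 r. \<exists>b\<in>B. dist a b \<le> d) \<and> (\<forall>b\<in>B \<inter> cball 0 r. \<exists>a\<in>A. dist a b \<le> d)"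

text \<open>Up to the attainment of infima this is \<open>\<Theta> \<T> A 0 r \<le> e\<close>: it implies that inequality
  and follows from the strict one (\<open>approximable_if_Theta_less\<close>,
  \<open>Theta_le_if_approximable\<close>).\<close>

definition approximable :: "'a::euclidean_space set set \<Rightarrow> real \<Rightarrow> real \<Rightarrow> 'a set \<Rightarrow> bool" where
  "approximable \<T> e r A \<longleftrightarrow> (\<exists>S\<in>\<T>. close_on r (e * r) A S)"

lemma close_on_sym: "close_on r d A B \<Longrightarrow> close_on r d B A"
  unfolding close_on_def by (metis dist_commute)

lemma close_on_mono: "close_on r d A B \<Longrightarrow> r' \<le> r \<Longrightarrow> d \<le> d' \<Longrightarrow> close_on r' d' A B"
  unfolding close_on_def Ball_def Bex_def Int_iff mem_cball by (meson order_trans)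

lemma close_on_scale:
  assumes "close_on r d A B" "c > 0"
  shows "close_on (c * r) (c * d) ((*\<^sub>R) c ` A) ((*\<^sub>R) c ` B)"
proof -
  have "dist (c *\<^sub>R a) (c *\<^sub>R b) \<le> c * d \<longleftrightarrow> dist a b \<le> d" for a b :: 'a
    using assms(2) by (simp add: dist_norm scaleR_diff_right[symmetric])
  moreover have "c *\<^sub>R a \<in> cball 0 (c * r) \<longleftrightarrow> a \<in> cball 0 r" for a :: 'a
    using assms(2) by simp
  ultimately show ?thesis using assms(1) unfolding close_on_def by fastforce
qed

text \<open>The intermediate point may leave the ball of radius \<open>r\<close> by up to \<open>d\<close> or \<open>e\<close>; hence the
  hypotheses at radius \<open>2 * r\<close>.\<close>

lemma close_on_trans:
  assumes "close_on (2 * r) d A B" "close_on (2 * r) e B C" "d \<le> r" "e \<le> r"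
  shows "close_on r (d + e) A C"
proof -
  \<comment> \<open>One direction for arbitrary sets; the other one is the same fact for the reversed chain.\<close>
  have half: "\<exists>c\<in>C. dist a c \<le> d + e"
    if H: "close_on (2 * r) d A B" "close_on (2 * r) e B C" "d \<le> r" "a \<in> A \<inter> cball 0 r"
    for A B C :: "'a set" and d e a
  proof -
    have "0 \<le> r" using H(4) norm_ge_zero[of a] by (auto intro: order_trans[OF norm_ge_zero])
    then have "a \<in> cball 0 (2 * r)" using H(4) by auto
    then obtain b where b: "b \<in> B" "dist a b \<le> d"
      using H(1,4) unfolding close_on_def by blast
    have "dist 0 b \<le> dist 0 a + dist a b" by (rule dist_triangle)
    then have "b \<in> cball 0 (2 * r)" using b H by auto
    then obtain c where c: "c \<in> C" "dist b c \<le> e"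
      using H(2) b(1) unfolding close_on_def by blast
    have "dist a c \<le> dist a b + dist b c" by (rule dist_triangle)
    then show ?thesis using b c by (intro bexI[of _ c]) auto
  qed
  show ?thesis
    unfolding close_on_def
  proof (intro conjI ballI)
    fix c assume "c \<in> C \<inter> cball 0 r"
    from half[OF close_on_sym[OF assms(2)] close_on_sym[OF assms(1)] assms(4) this]
    show "\<exists>a\<in>A. dist a c \<le> d + e" by (auto simp: dist_commute add.commute)
  qed (use half[OF assms(1-3)] in auto)
qed

lemma approximable_if_Theta_less:
  assumes "\<Theta> \<T> A 0 r < ennreal e" "r > 0"
  shows "approximable \<T> e r A"
proof -
  obtain S where S: "S \<in> \<T>" "rel_excess 0 r A S < ennreal e"
    using assms(1) by (auto simp: \<Theta>_def INF_less_iff)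
  let ?m = "max (excess (A \<inter> cball 0 r) S) (excess (S \<inter> cball 0 r) A)"
  have e: "e > 0" using assms(1) by (cases "e > 0") (auto simp: ennreal_neg)
  have "?m < ennreal (e * r)"
  proof (rule ccontr)
    assume "\<not> ?m < ennreal (e * r)"
    then have "ennreal (e * r) / ennreal r \<le> rel_excess 0 r A S"
      unfolding rel_excess_def by (intro divide_right_mono_ennreal) (simp add: not_less le_max_iff_disj)
    moreover have "ennreal (e * r) / ennreal r = ennreal e"
      using assms(2) e by (simp add: divide_ennreal)
    ultimately show False using S(2) by simp
  qed
  then have m: "excess (A \<inter> cball 0 r) S < ennreal (e * r)" "excess (S \<inter> cball 0 r) A < ennreal (e * r)"
    by auto
  have "close_on r (e * r) A S"
    unfolding close_on_def using excess_less_imp_near[OF m(1)] excess_less_imp_near[OF m(2)]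
    by (metis dist_commute less_imp_le)
  then show ?thesis using S(1) by (auto simp: approximable_def)
qed

lemma Theta_le_if_approximable:
  assumes "approximable \<T> e r A" "r > 0" "e \<ge> 0"
  shows "\<Theta> \<T> A 0 r \<le> ennreal e"
proof -
  obtain S where S: "S \<in> \<T>" "close_on r (e * r) A S" using assms by (auto simp: approximable_def)
  have "max (excess (A \<inter> cball 0 r) S) (excess (S \<inter> cball 0 r) A) \<le> ennreal (e * r)"
    using S(2) unfolding close_on_def
    by (auto intro!: near_imp_excess_le simp: dist_commute)
  then have "rel_excess 0 r A S \<le> ennreal (e * r) / ennreal r"
    unfolding rel_excess_def by (rule divide_right_mono_ennreal)
  also have "\<dots> = ennreal e" using assms by (simp add: divide_ennreal)
  finally show ?thesis using S(1) by (auto simp: \<Theta>_def intro: INF_lower2)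
qed

lemma approximable_mono: "approximable \<T> e r A \<Longrightarrow> e \<le> e' \<Longrightarrow> r \<ge> 0 \<Longrightarrow> approximable \<T> e' r A"
  unfolding approximable_def by (meson close_on_mono mult_right_mono order_refl)

text \<open>The absolute error \<open>e * r\<close> does not grow when the ball shrinks, so the relative error grows at
  most by the ratio of the radii.\<close>

lemma approximable_smaller_scale:
  assumes "approximable \<T> e r A" "0 < r'" "r' \<le> r"
  shows "approximable \<T> (e * r / r') r' A"
  using assms close_on_mono[of r "e * r" A _ r' "e * r"] unfolding approximable_def by auto

lemma approximable_scale:
  assumes "local_approximation_class \<T>" "c > 0"
  shows "approximable \<T> e (c * r) ((*\<^sub>R) c ` A) \<longleftrightarrow> approximable \<T> e r A"
proof -
  have imp: "approximable \<T> e (c * r) ((*\<^sub>R) c ` A)" if "approximable \<T> e r A" "c > 0" for c r A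
    using that assms(1) close_on_scale[of r "e * r" A _ c]
    unfolding approximable_def local_approximation_class_def by (metis mult.left_commute)
  have "approximable \<T> e (inverse c * (c * r)) ((*\<^sub>R) (inverse c) ` (*\<^sub>R) c ` A)"
    if "approximable \<T> e (c * r) ((*\<^sub>R) c ` A)" using imp[OF that] assms(2) by simp
  moreover have "(*\<^sub>R) (inverse c) ` (*\<^sub>R) c ` A = A" "inverse c * (c * r) = r"
    using assms(2) by (auto simp: image_image)
  ultimately show ?thesis using imp assms(2) by auto
qed

text \<open>The relative error of \<open>B\<close> at scale \<open>2 * r\<close> counts twice when it is measured against \<open>r\<close>.\<close>

lemma approximable_transfer:
  assumes "close_on (2 * r) (d * r) A B" "approximable \<T> e (2 * r) B" "r > 0" "d \<le> 1" "2 * e \<le> 1"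
  shows "approximable \<T> (d + 2 * e) r A"
proof -
  obtain S where S: "S \<in> \<T>" "close_on (2 * r) (2 * e * r) B S"
    using assms(2) by (auto simp: approximable_def algebra_simps)
  have "close_on r (d * r + 2 * e * r) A S"
    using assms S(2) by (intro close_on_trans[of r _ A B]) auto
  then show ?thesis using S(1) by (auto simp: approximable_def algebra_simps)
qed

section \<open>Sequential compactness of the closed sets through the origin\<close>

lemma aw_tendsto_iff_close_on:
  "aw_tendsto X A \<longleftrightarrow> (\<forall>r>0. \<forall>e>0. \<forall>\<^sub>F i in sequentially. close_on r e (X i) A)"
proof
  assume *: "aw_tendsto X A"
  show "\<forall>r>0. \<forall>e>0. \<forall>\<^sub>F i in sequentially. close_on r e (X i) A"
  proof (intro allI impI)
    fix r e :: real assume "r > 0" "e > 0"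
    then have "\<forall>\<^sub>F i in sequentially. excess (X i \<inter> cball 0 r) A < ennreal e"
        "\<forall>\<^sub>F i in sequentially. excess (A \<inter> cball 0 r) (X i) < ennreal e"
      using * by (auto simp: aw_tendsto_def intro!: order_tendstoD(2)[where y = 0])
    then show "\<forall>\<^sub>F i in sequentially. close_on r e (X i) A"
    proof eventually_elim
      case (elim i)
      then show ?case unfolding close_on_def
        using excess_less_imp_near[OF elim(1)] excess_less_imp_near[OF elim(2)]
        by (metis dist_commute less_imp_le)
    qed
  qed
next
  assume *: "\<forall>r>0. \<forall>e>0. \<forall>\<^sub>F i in sequentially. close_on r e (X i) A"
  have lim: "(\<lambda>i. f i) \<longlonglongrightarrow> 0" if "\<And>e. e > 0 \<Longrightarrow> \<forall>\<^sub>F i in sequentially. f i \<le> ennreal e"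
    for f :: "nat \<Rightarrow> ennreal"
  proof (rule order_tendstoI)
    fix a :: ennreal assume "0 < a"
    then obtain b where "0 < b" "b < a" using dense by blast
    then obtain e where "b = ennreal e" "e > 0" by (cases b) auto
    then show "\<forall>\<^sub>F i in sequentially. f i < a"
      using that[of e] \<open>b < a\<close> by (auto elim: eventually_mono)
  qed simp
  show "aw_tendsto X A"
    unfolding aw_tendsto_def
  proof (intro allI impI conjI; rule lim)
    fix r e :: real assume re: "r > 0" "e > 0"
    then have "\<forall>\<^sub>F i in sequentially. close_on r e (X i) A" using * by blast
    then show "\<forall>\<^sub>F i in sequentially. excess (X i \<inter> cball 0 r) A \<le> ennreal e"
      "\<forall>\<^sub>F i in sequentially. excess (A \<inter> cball 0 r) (X i) \<le> ennreal e"
      by (eventually_elim, auto simp: close_on_def dist_commute intro!: near_imp_excess_le)+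
  qed
qed

text \<open>A closed set is encoded by its distance function. All these functions are
  \<open>1\<close>-Lipschitz and, as the sets contain \<open>0\<close>, bounded at each point. A diagonal subsequence
  converges on a countable dense set, hence everywhere, and the zero set of the limit function is the
  limit set. Compactness of balls makes the convergence locally uniform.\<close>

lemma aw_sequentially_compact:
  fixes X :: "nat \<Rightarrow> 'a::euclidean_space set"
  assumes X: "\<And>n. X n \<in> closed_through_0"
  obtains k S where "strict_mono k" "S \<in> closed_through_0" "aw_tendsto (X \<circ> k) S"
proof -
  have X0: "0 \<in> X n" and Xc: "closed (X n)" for n using X by (auto simp: closed_through_0_def)
  obtain Q :: "'a set" where Q: "countable Q" "\<And>U. open U \<Longrightarrow> U \<noteq> {} \<Longrightarrow> \<exists>q\<in>Q. q \<in> U"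
    by (rule countable_dense_setE) blast
  \<comment> \<open>Dividing by \<open>1 + norm q\<close> turns the pointwise bound into one that is uniform in \<open>q\<close>, as
     the diagonal argument requires.\<close>
  have bnd: "norm (infdist q (X n) / (1 + norm q)) \<le> 1" for q n
  proof -
    have "infdist q (X n) \<le> dist q 0" using X0 by (rule infdist_le)
    then have "infdist q (X n) \<le> 1 + norm q" by simp
    then show ?thesis using norm_ge_zero[of q]
      by (simp add: infdist_nonneg divide_le_eq add_pos_nonneg del: norm_ge_zero)
  qed
  obtain k where k: "strict_mono k"
    and kl: "\<And>q. q \<in> Q \<Longrightarrow> \<exists>l. (\<lambda>n. infdist q (X (k n)) / (1 + norm q)) \<longlonglongrightarrow> l"
    using function_convergent_subsequence[OF Q(1), of "\<lambda>n q. infdist q (X n) / (1 + norm q)" 1] bnd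
    by metis
  have convQ: "convergent (\<lambda>n. infdist q (X (k n)))" if qQ: "q \<in> Q" for q
  proof -
    obtain l where "(\<lambda>n. infdist q (X (k n)) / (1 + norm q)) \<longlonglongrightarrow> l" using kl[OF qQ] by blast
    then have "(\<lambda>n. infdist q (X (k n)) / (1 + norm q) * (1 + norm q)) \<longlonglongrightarrow> l * (1 + norm q)"
      by (intro tendsto_intros)
    moreover have "1 + norm q \<noteq> 0" using norm_ge_zero[of q] by linarith
    ultimately show ?thesis by (auto simp: convergent_def)
  qed
  have lip: "\<bar>infdist y (X n) - infdist z (X n)\<bar> \<le> dist y z" for y z n
    using infdist_triangle[of y "X n" z] infdist_triangle[of z "X n" y] by (simp add: dist_commute)
  have conv: "convergent (\<lambda>n. infdist y (X (k n)))" for y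
    unfolding Cauchy_convergent_iff[symmetric]
  proof (rule metric_CauchyI)
    fix e :: real assume "e > 0"
    then obtain q where q: "q \<in> Q" "dist y q < e / 3" using Q(2)[of "ball y (e / 3)"] by auto
    have "Cauchy (\<lambda>n. infdist q (X (k n)))" using convQ[OF q(1)] by (simp add: Cauchy_convergent_iff)
    then obtain M where M: "\<And>m n. m \<ge> M \<Longrightarrow> n \<ge> M \<Longrightarrow>
        dist (infdist q (X (k m))) (infdist q (X (k n))) < e / 3"
      using \<open>e > 0\<close> by (metis metric_CauchyD divide_pos_pos zero_less_numeral)
    show "\<exists>M. \<forall>m\<ge>M. \<forall>n\<ge>M. dist (infdist y (X (k m))) (infdist y (X (k n))) < e"
    proof (intro exI[of _ M] allI impI)
      fix m n assume "m \<ge> M" "n \<ge> M"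
      from M[OF this] lip[of y "k m" q] lip[of y "k n" q] q(2)
      show "dist (infdist y (X (k m))) (infdist y (X (k n))) < e"
        unfolding dist_real_def by linarith
    qed
  qed
  define S where "S = {y. (\<lambda>n. infdist y (X (k n))) \<longlonglongrightarrow> 0}"
  have S_iff: "y \<in> S \<longleftrightarrow> (\<forall>e>0. \<forall>\<^sub>F n in sequentially. infdist y (X (k n)) < e)" for y
    unfolding S_def tendsto_iff by (simp add: dist_real_def infdist_nonneg)
  have S0: "0 \<in> S" using X0 by (simp add: S_iff)
  have "closed S"
    unfolding closure_subset_eq[symmetric]
  proof
    fix y assume y: "y \<in> closure S"
    show "y \<in> S"
      unfolding S_iff
    proof (intro allI impI)
      fix e :: real assume "e > 0"
      then obtain z where z: "z \<in> S" "dist z y < e / 2"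
        using y by (meson closure_approachable half_gt_zero)
      have "\<forall>\<^sub>F n in sequentially. infdist z (X (k n)) < e / 2"
        using z(1) \<open>e > 0\<close> unfolding S_iff by (meson half_gt_zero)
      then show "\<forall>\<^sub>F n in sequentially. infdist y (X (k n)) < e"
      proof eventually_elim
        case (elim n) then show ?case using lip[of y "k n" z] z by (simp add: dist_commute)
      qed
    qed
  qed
  have near: "\<forall>\<^sub>F n in sequentially. \<forall>s\<in>S \<inter> cball 0 r. infdist s (X (k n)) \<le> e" if "e > 0" for r e
  proof -
    have "compact (S \<inter> cball 0 r)" using \<open>closed S\<close> by (simp add: closed_Int_compact)
    then obtain N where N: "finite N" "N \<subseteq> S \<inter> cball 0 r" "S \<inter> cball 0 r \<subseteq> (\<Union>z\<in>N. ball z (e / 2))"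
      using \<open>e > 0\<close> seq_compact_imp_totally_bounded[of "S \<inter> cball 0 r"]
      by (meson compact_eq_seq_compact_metric half_gt_zero)
    have "\<forall>\<^sub>F n in sequentially. \<forall>z\<in>N. infdist z (X (k n)) < e / 2"
    proof (rule eventually_ball_finite[OF N(1)], rule)
      fix z assume "z \<in> N"
      then have "z \<in> S" using N(2) by blast
      then show "\<forall>\<^sub>F n in sequentially. infdist z (X (k n)) < e / 2"
        using \<open>e > 0\<close> unfolding S_iff by (meson half_gt_zero)
    qed
    then show ?thesis
    proof eventually_elim
      case (elim n)
      show ?case
      proof
        fix s assume "s \<in> S \<inter> cball 0 r"
        then obtain z where "z \<in> N" "dist z s < e / 2" using N by auto
        then show "infdist s (X (k n)) \<le> e"
          using elim lip[of s "k n" z] by (force simp: dist_commute)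
      qed
    qed
  qed
  have far: "\<forall>\<^sub>F n in sequentially. \<forall>a\<in>X (k n) \<inter> cball 0 r. infdist a S \<le> e" if "e > 0" for r e
  proof (rule ccontr)
    assume "\<not> ?thesis"
    then have "\<exists>\<^sub>F n in sequentially. \<exists>a\<in>X (k n) \<inter> cball 0 r. infdist a S > e"
      by (simp add: not_eventually not_le)
    then have "infinite {n. \<exists>a\<in>X (k n) \<inter> cball 0 r. infdist a S > e}"
      by (simp add: frequently_cofinite[symmetric] cofinite_eq_sequentially)
    from infinite_enumerate[OF this] obtain p :: "nat \<Rightarrow> nat" where p: "strict_mono p"
      "\<And>n. \<exists>a\<in>X (k (p n)) \<inter> cball 0 r. infdist a S > e"
      unfolding mem_Collect_eq by metis
    then obtain a where a: "\<And>n. a n \<in> X (k (p n))" "\<And>n. a n \<in> cball 0 r" "\<And>n. infdist (a n) S > e"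
      unfolding Bex_def Int_iff by metis
    obtain y q where q: "strict_mono q" "(a \<circ> q) \<longlonglongrightarrow> y"
      using compact_cball[of "0::'a" r] a(2) unfolding compact_def by metis
    \<comment> \<open>The limit \<open>y\<close> of points of the \<open>X (k n)\<close> is in \<open>S\<close>: along the subsequence the distances from
       \<open>y\<close> tend to \<open>0\<close>, and the full sequence of distances converges.\<close>
    have lim: "(\<lambda>n. dist ((a \<circ> q) n) y) \<longlonglongrightarrow> 0" using q(2) tendsto_dist_iff by blast
    have le: "\<forall>n. norm (infdist y (X (k (p (q n))))) \<le> dist ((a \<circ> q) n) y"
      using infdist_le[OF a(1), of y] by (simp add: infdist_nonneg dist_commute)
    have lim_0: "(\<lambda>n. infdist y (X (k (p (q n))))) \<longlonglongrightarrow> 0"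
      by (rule Lim_null_comparison[OF always_eventually[OF le] lim])
    obtain l where l: "(\<lambda>n. infdist y (X (k n))) \<longlonglongrightarrow> l"
      using conv by (auto simp: convergent_def)
    then have "(\<lambda>n. infdist y (X (k (p (q n))))) \<longlonglongrightarrow> l"
      using LIMSEQ_subseq_LIMSEQ[OF l strict_mono_o[OF p(1) q(1)]] by (simp add: o_def)
    then have "l = 0" using lim_0 by (rule LIMSEQ_unique)
    then have "y \<in> S" using l by (simp add: S_def)
    have "\<forall>\<^sub>F n in sequentially. dist ((a \<circ> q) n) y < e" using q(2) \<open>e > 0\<close> by (rule tendstoD)
    then obtain n where "dist (a (q n)) y < e" by (auto simp: eventually_sequentially)
    then show False using infdist_le[OF \<open>y \<in> S\<close>, of "a (q n)"] a(3)[of "q n"] by simp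
  qed
  have "aw_tendsto (X \<circ> k) S"
    unfolding aw_tendsto_iff_close_on
  proof (intro allI impI)
    fix r e :: real assume "r > 0" "e > 0"
    have attain: "\<exists>b\<in>B. dist a b \<le> e"
      if H: "infdist a B \<le> e" "closed B" "0 \<in> B" for a and B :: "'a set"
    proof -
      have "B \<noteq> {}" using H(3) by blast
      then obtain b where "b \<in> B" "infdist a B = dist a b"
        using infdist_attains_inf[OF H(2)] by blast
      then show ?thesis using H(1) by (intro bexI[of _ b]) simp_all
    qed
    show "\<forall>\<^sub>F i in sequentially. close_on r e ((X \<circ> k) i) S"
      using near[OF \<open>e > 0\<close>, of r] far[OF \<open>e > 0\<close>, of r]
    proof eventually_elim
      case (elim n)
      then show ?case
        unfolding close_on_def using attain[OF _ Xc X0] attain[OF _ \<open>closed S\<close> S0]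
        by (simp add: dist_commute)
    qed
  qed
  then show ?thesis using that k \<open>closed S\<close> S0 by (auto simp: closed_through_0_def)
qed

section \<open>The dichotomy for tangents\<close>

lemma separated_imp_in_closure:
  assumes "\<And>S. S \<in> \<S> - aw_closure \<T> \<Longrightarrow> Limsup at_top (\<lambda>r. \<Theta> \<T> S 0 r) \<ge> ennreal \<phi>"
    and "S \<in> \<S>" "0 \<le> e" "e < \<phi>" "\<And>r. r \<ge> 1 \<Longrightarrow> approximable \<T> e r S"
  shows "S \<in> aw_closure \<T>"
proof (rule ccontr)
  assume "S \<notin> aw_closure \<T>"
  then have "ennreal \<phi> \<le> Limsup at_top (\<lambda>r. \<Theta> \<T> S 0 r)" using assms by blast
  also have "\<dots> \<le> ennreal e"
    using assms(3,5)
    by (intro Limsup_bounded eventually_mono[OF eventually_ge_at_top[of 1]])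
       (auto intro: Theta_le_if_approximable)
  finally show False using assms(3,4) by (simp add: ennreal_le_iff)
qed

text \<open>Used through its contrapositive: for a tangent outside the singular class, a single
  scale at which it is close to \<open>\<T>\<close> already gives arbitrarily small such scales of the set to which
  it is tangent.\<close>

lemma singular_classI:
  assumes "D \<in> closed_through_0" "e > 0" "\<And>s. s > 0 \<Longrightarrow> \<not> approximable \<T> e s D"
  shows "D \<in> singular_class \<T>"
proof -
  have "\<forall>\<^sub>F r in at_right 0. ennreal e \<le> \<Theta> \<T> D 0 r"
    using approximable_if_Theta_less assms(3)
    by (force intro: eventually_mono[OF eventually_at_right_less] simp: not_le[symmetric])
  then have "ennreal e \<le> Liminf (at_right 0) (\<lambda>r. \<Theta> \<T> D 0 r)" by (rule Liminf_bounded)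
  moreover have "0 < ennreal e" using assms(2) by simp
  ultimately show ?thesis
    using assms(1) by (auto simp: singular_class_def intro: order.strict_trans2[of 0 "ennreal e"])
qed

lemma approximable_if_in_closure:
  assumes "\<T> \<subseteq> closed_through_0" "S \<in> aw_closure \<T>" "e > 0" "r > 0"
  shows "approximable \<T> e r S"
proof -
  obtain X where X: "range X \<subseteq> \<T>" "aw_tendsto X S"
    using assms(2) unfolding closure_of_attouch_wets[OF assms(1)] by blast
  have "\<forall>\<^sub>F i in sequentially. close_on r (e * r) (X i) S"
    using X(2) assms(3,4) by (auto simp: aw_tendsto_iff_close_on)
  then obtain i where "close_on r (e * r) (X i) S" by (auto simp: eventually_sequentially)
  then show ?thesis using X(1) close_on_sym unfolding approximable_def by blast
qed

text \<open>Tangents of both kinds would make good and bad scales of \<open>A\<close> alternate. Blowing up \<open>A\<close> at bad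
  scales that are followed by ever longer ranges without bad scales gives a tangent that violates
  the gap at infinity.\<close>

lemma tangents_dichotomy:
  fixes \<T> \<S> :: "'a::euclidean_space set set" and A :: "'a set"
  assumes T: "local_approximation_class \<T>" and sep: "separated_at_infinity \<T> \<S>"
    and A: "closed A" "x \<in> A" and tan: "Tan A x \<subseteq> \<S>"
  shows "Tan A x \<subseteq> aw_closure \<T> \<or> Tan A x \<subseteq> singular_class \<T>"
proof (rule ccontr)
  assume "\<not> ?thesis"
  then obtain B D where B: "B \<in> Tan A x" "B \<notin> aw_closure \<T>"
    and D: "D \<in> Tan A x" "D \<notin> singular_class \<T>" by blast
  obtain \<phi> where phi: "\<phi> > 0"
    "\<And>S. S \<in> \<S> - aw_closure \<T> \<Longrightarrow> Limsup at_top (\<lambda>r. \<Theta> \<T> S 0 r) \<ge> ennreal \<phi>"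
    using sep by (auto simp: separated_at_infinity_def)
  \<comment> \<open>Transfer turns an error \<open>c\<close> into at most \<open>3 * c\<close>, which has to stay below \<open>\<phi>\<close>, and it requires
     \<open>2 * c \<le> 1\<close>.\<close>
  define c where "c = min \<phi> 1 / 4"
  have c: "c > 0" "3 * c < \<phi>" "2 * c \<le> 1" "c \<le> 1" using phi(1) by (auto simp: c_def min_def)
  define Z where "Z r = (\<lambda>a. (a - x) /\<^sub>R r) ` A" for r :: real
  let ?P = "\<lambda>e r. approximable \<T> e r ((\<lambda>a. a - x) ` A)"
  have P_Z: "approximable \<T> e s (Z r) \<longleftrightarrow> ?P e (r * s)" if "r > 0" for e r s
    using approximable_scale[OF T, of r e s "Z r"] that by (simp add: Z_def image_image)
  have Tan_iff: "S \<in> Tan A x \<longleftrightarrow> S \<in> closed_through_0 \<and>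
      (\<exists>r. (\<forall>i. r i > 0) \<and> r \<longlonglongrightarrow> 0 \<and> aw_tendsto (\<lambda>i. Z (r i)) S)" for S
    by (simp add: Tan_def Z_def)

  \<comment> \<open>Good scales, from the tangent \<open>D\<close> that is not singular.\<close>
  have good: "\<exists>a. 0 < a \<and> a < \<rho> \<and> ?P e a" if "e > 0" "\<rho> > 0" for e \<rho>
  proof -
    define e' where "e' = min e 1 / 3"
    have e': "e' > 0" "3 * e' \<le> e" "2 * e' \<le> 1" "e' \<le> 1" using that by (auto simp: e'_def)
    obtain r where r: "D \<in> closed_through_0" "\<And>i. r i > 0" "r \<longlonglongrightarrow> 0" "aw_tendsto (\<lambda>i. Z (r i)) D"
      using D(1) by (auto simp: Tan_iff)
    obtain s where s: "s > 0" "approximable \<T> e' s D"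
      using singular_classI[OF r(1) e'(1)] D(2) by blast
    have "\<forall>\<^sub>F i in sequentially. close_on s (e' * (s / 2)) (Z (r i)) D"
      using r(4) s e' by (auto simp: aw_tendsto_iff_close_on)
    moreover have "\<forall>\<^sub>F i in sequentially. r i < \<rho> / s"
      using r(3) s(1) that by (intro order_tendstoD(2)) auto
    ultimately have "\<forall>\<^sub>F i in sequentially. close_on s (e' * (s / 2)) (Z (r i)) D \<and> r i < \<rho> / s"
      by eventually_elim auto
    then obtain i where i: "close_on s (e' * (s / 2)) (Z (r i)) D" "r i < \<rho> / s"
      by (auto simp: eventually_sequentially)
    have "approximable \<T> (e' + 2 * e') (s / 2) (Z (r i))"
      using approximable_transfer[of "s / 2" e' "Z (r i)" D \<T> e'] i s e' by simp
    then have "?P (e' + 2 * e') (r i * (s / 2))" using r(2) by (simp add: P_Z)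
    then have "?P e (r i * (s / 2))" by (rule approximable_mono) (use e' r(2)[of i] s in auto)
    moreover have "r i * (s / 2) < \<rho>"
      using i(2) s(1) r(2)[of i] that by (simp add: field_simps)
    ultimately show ?thesis using r(2)[of i] s(1) by (intro exI[of _ "r i * (s / 2)"]) auto
  qed

  \<comment> \<open>Bad scales, from the tangent \<open>B\<close> outside the closure of \<open>\<T>\<close>.\<close>
  have bad: "\<exists>b. 0 < b \<and> b < \<rho> \<and> \<not> ?P c b" if "\<rho> > 0" for \<rho>
  proof -
    obtain r where r: "\<And>i. r i > 0" "r \<longlonglongrightarrow> 0" "aw_tendsto (\<lambda>i. Z (r i)) B"
      using B(1) by (auto simp: Tan_iff)
    obtain R where R: "R \<ge> 1" "\<not> approximable \<T> (3 * c) R B"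
      using separated_imp_in_closure[of \<S> \<T> \<phi> B "3 * c"] phi(2) B tan c by fastforce
    have "\<forall>\<^sub>F i in sequentially. close_on (2 * R) (c * R) (Z (r i)) B"
      using r(3) R c by (auto simp: aw_tendsto_iff_close_on)
    moreover have "\<forall>\<^sub>F i in sequentially. r i < \<rho> / (2 * R)"
      using r(2) R(1) that by (intro order_tendstoD(2)) auto
    ultimately have "\<forall>\<^sub>F i in sequentially. close_on (2 * R) (c * R) (Z (r i)) B \<and> r i < \<rho> / (2 * R)"
      by eventually_elim auto
    then obtain i where i: "close_on (2 * R) (c * R) (Z (r i)) B" "r i < \<rho> / (2 * R)"
      by (auto simp: eventually_sequentially)
    have "\<not> approximable \<T> c (2 * R) (Z (r i))"
      using approximable_transfer[OF close_on_sym[OF i(1)], of \<T> c] R c by auto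
    then have "\<not> ?P c (r i * (2 * R))" using r(1) by (simp add: P_Z)
    moreover have "r i * (2 * R) < \<rho>" using i(2) R(1) by (simp add: field_simps)
    ultimately show ?thesis using r(1)[of i] R(1) by (intro exI[of _ "r i * (2 * R)"]) auto
  qed

  \<comment> \<open>A bad scale followed by a long range of scales that are not bad.\<close>
  have "\<exists>b. 0 < b \<and> b < 1 / real (Suc n) \<and> \<not> ?P c b \<and>
      (\<forall>s. 2 \<le> s \<longrightarrow> s \<le> real (Suc n) \<longrightarrow> ?P c (b * s))" for n
  proof -
    obtain a where a: "0 < a" "a < 1 / real (Suc n)" "?P (c / real (Suc n)) a"
      using good[of "c / real (Suc n)" "1 / real (Suc n)"] c by auto
    define Y where "Y = {b. 0 < b \<and> b < a \<and> \<not> ?P c b}"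
    have Y: "Y \<noteq> {}" "bdd_above Y" using bad[OF a(1)] by (auto simp: Y_def intro!: bdd_aboveI[of _ a])
    \<comment> \<open>The supremum of the bad scales below \<open>a\<close> need not be bad. A bad scale above half of it
       suffices, because then every scale in \<open>[2 * b, a)\<close> exceeds the supremum.\<close>
    have "0 < Sup Y" using Y cSup_upper[OF _ Y(2)] by (fastforce simp: Y_def)
    then obtain b where b: "b \<in> Y" "Sup Y / 2 < b" using less_cSupD[OF Y(1), of "Sup Y / 2"] by auto
    have ratio: "b * real (Suc n) < a"
    proof (rule ccontr)
      assume "\<not> ?thesis"
      then have "c / real (Suc n) * a / b \<le> c"
        using b(1) c(1) mult_left_mono[of a "b * real (Suc n)" c]
        by (simp add: Y_def field_simps del: of_nat_Suc)
      moreover have "?P (c / real (Suc n) * a / b) b"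
        using approximable_smaller_scale[OF a(3)] b(1) by (auto simp: Y_def)
      ultimately show False using b(1) approximable_mono by (fastforce simp: Y_def)
    qed
    have "?P c (b * s)" if "2 \<le> s" "s \<le> real (Suc n)" for s
    proof (rule ccontr)
      assume np: "\<not> ?P c (b * s)"
      have "b * s \<le> b * real (Suc n)" "2 * b \<le> b * s"
        using that b(1) by (auto simp: Y_def simp del: of_nat_Suc)
      moreover have "0 < b * s" using b(1) that(1) by (simp add: Y_def)
      ultimately have "0 < b * s" "b * s < a" using ratio by linarith+
      then have "b * s \<in> Y" using np by (simp add: Y_def)
      then have "b * s \<le> Sup Y" using Y(2) by (rule cSup_upper)
      then show False using b \<open>2 * b \<le> b * s\<close> by linarith
    qed
    then show ?thesis using a b(1) by (intro exI[of _ b]) (auto simp: Y_def)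
  qed
  then obtain b where b: "\<And>n. 0 < b n" "\<And>n. b n < 1 / real (Suc n)" "\<And>n. \<not> ?P c (b n)"
    "\<And>n s. 2 \<le> s \<Longrightarrow> s \<le> real (Suc n) \<Longrightarrow> ?P c (b n * s)" by metis
  have Z0: "Z (b n) \<in> closed_through_0" for n
  proof -
    have "Z (b n) = (*\<^sub>R) (inverse (b n)) ` (\<lambda>a. a - x) ` A" by (simp add: Z_def image_image)
    moreover have "closed ((\<lambda>a. a - x) ` A)"
      using closed_translation[OF A(1), of "- x"] by (simp add: add.commute)
    ultimately have "closed (Z (b n))" by (simp add: closed_scaling)
    then show ?thesis using A(2) by (force simp: Z_def closed_through_0_def)
  qed
  \<comment> \<open>Blowing up at the scales \<open>b n\<close> makes the limit \<open>S\<close> close to \<open>\<T>\<close> at infinity while it stays away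
     from \<open>\<T>\<close> near scale \<open>1\<close>.\<close>
  obtain k S where k: "strict_mono k" "S \<in> closed_through_0" "aw_tendsto ((\<lambda>n. Z (b n)) \<circ> k) S"
    using aw_sequentially_compact[of "\<lambda>n. Z (b n)"] Z0 by metis
  have "b \<longlonglongrightarrow> 0"
    using b(1,2) by (intro tendsto_sandwich[OF _ _ tendsto_const LIMSEQ_inverse_real_of_nat])
      (auto intro!: always_eventually less_imp_le simp: inverse_eq_divide)
  then have "(b \<circ> k) \<longlonglongrightarrow> 0" using k(1) by (rule LIMSEQ_subseq_LIMSEQ)
  then have S: "S \<in> Tan A x"
    unfolding Tan_iff using k(2,3) b(1) by (intro conjI exI[of _ "b \<circ> k"]) (simp_all add: o_def)
  have near: "\<forall>\<^sub>F n in sequentially. close_on r e (Z (b (k n))) S" if "r > 0" "e > 0" for r e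
    using k(3) that by (auto simp: aw_tendsto_iff_close_on)

  have S_at_infinity: "approximable \<T> (3 * c) r S" if "r \<ge> 1" for r
  proof -
    have "\<forall>\<^sub>F n in sequentially. 2 * r \<le> real n"
      using filterlim_real_sequentially by (simp add: filterlim_at_top)
    moreover have "\<forall>\<^sub>F n in sequentially. close_on (2 * r) (c * r) (Z (b (k n))) S"
      using near that c by simp
    ultimately have "\<forall>\<^sub>F n in sequentially. approximable \<T> (3 * c) r S"
    proof eventually_elim
      case (elim n)
      have "real n \<le> real (k n)" using k(1) by (simp add: seq_suble)
      then have "?P c (b (k n) * (2 * r))" using elim that by (intro b(4)) auto
      then have "approximable \<T> c (2 * r) (Z (b (k n)))" using b(1) by (simp add: P_Z)
      from approximable_transfer[OF close_on_sym[OF elim(2)] this] show ?case using that c by simp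
    qed
    then show ?thesis by simp
  qed
  have "S \<in> aw_closure \<T>"
    by (rule separated_imp_in_closure[OF phi(2) _ _ c(2)]) (use S tan c S_at_infinity in auto)
  \<comment> \<open>Hence \<open>S\<close> is arbitrarily close to \<open>\<T>\<close> at scale \<open>2\<close>, and so late blow-ups are close to \<open>\<T>\<close> at scale
     \<open>1\<close>, although the scales \<open>b n\<close> are bad.\<close>
  then have appr: "approximable \<T> (c / 3) 2 S"
    using T c by (intro approximable_if_in_closure) (auto simp: local_approximation_class_def)
  obtain n where n: "close_on 2 (c / 3) (Z (b (k n))) S"
    using near[of 2 "c / 3"] c by (auto simp: eventually_sequentially)
  have "approximable \<T> c 1 (Z (b (k n)))"
    using approximable_transfer[of 1 "c / 3" "Z (b (k n))" S \<T> "c / 3"] appr n c by simp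
  then show False using b(1,3) P_Z[of "b (k n)" c 1] by simp
qed

theorem theorem5p3:
  fixes \<T> \<S> :: "(real ^ 'n) set set" and A :: "(real ^ 'n) set" and x :: "real ^ 'n"
  assumes "local_approximation_class \<T>"
    and "local_approximation_class \<S>"
    and "separated_at_infinity \<T> \<S>"
    and "closed A"
    and "x \<in> A"
    and "Tan A x \<subseteq> \<S>"
  shows "Tan A x \<subseteq> aw_closure \<T> \<or> Tan A x \<subseteq> singular_class \<T>"
  using tangents_dichotomy[OF assms(1,3-6)] .

end
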